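(* Let $F_0(z,x)$ and $F_1(z,x)$ be the generating functions of bicolored Motzkin paths defined in the context. Then $F_1$ is the generating function of double deficiencies over $321$-avoiding permutations, $$F_1(z,x)=\sum_{n\ge 0} f_{321}(n,x)z^n,$$ and, as formal power series in $z$ with coefficients in $\mathbb{Z}[x]$, $$F_0(z,x)=1+(1+x)zF_0(z,x)+z^2F_0(z,x)^2,\qquad F_1(z,x)=1+zF_1(z,x)+z^2F_0(z,x)F_1(z,x),$$ and consequently $$F_0(z,x)=\frac{1-(1+x)z-\sqrt{1-2z-2xz-3z^2+2xz^2+x^2z^2}}{2z^2},$$ $$F_1(z,x)=\frac{2}{1-z+xz+\sqrt{1-2z-2xz-3z^2+2xz^2+x^2z^2}}.$$ Moreover, writing $F_0(z,x)=\sum_{n\ge0}g(n,x)z^n$, one has $g(0,x)=f_{321}(0,x)=1$ and, for $n\ge1$, $$g(n,x)=(1+x)g(n-1,x)+\sum_{i=2}^{n}g(i-2,x)\,g(n-i,x),$$ $$f_{321}(n,x)=f_{321}(n-1,x)+\sum_{i=2}^{n}g(i-2,x)\,f_{321}(n-i,x).$$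
   Context: $\mathfrak S_n$ is the set of permutations of $[n]=\{1,\dots,n\}$. For $\pi\in\mathfrak S_n$, an index $k\in[n]$ is a double deficiency if $\pi(k)<k<\pi^{-1}(k)$, and $\operatorname{DD}(\pi)$ is the number of double deficiencies of $\pi$. $\operatorname{Av}_n(321)$ is the set of $\pi\in\mathfrak S_n$ with no subsequence order-isomorphic to $321$, and $f_{321}(n,x)=\sum_{\pi\in\operatorname{Av}_n(321)}x^{\operatorname{DD}(\pi)}$. A Motzkin path of length $n$ is a lattice path from $(0,0)$ to $(n,0)$ with steps $U=(1,1)$, $L=(1,0)$, $D=(1,-1)$ that never passes below the $x$-axis. $F_1(z,x)$ is the generating function, with $z$ marking length and $x$ marking the number of red level steps, of Motzkin paths in which every level step strictly above the $x$-axis is either uncolored or red, while every level step on the $x$-axis is uncolored. $F_0(z,x)$ is the analogous generating function in which every level step (including those on the $x$-axis) is either uncolored or red. The square root denotes the formal power series in $z$ with constant term $1$. *)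

theory Defs
  imports
    "HOL-Computational_Algebra.Computational_Algebra"
    "HOL-Combinatorics.Permutations"
    "HOL-Library.Sublist"
begin

abbreviation x_var :: "int poly" where
  "x_var \<equiv> [:0, 1:]"

subsection \<open>Pattern avoidance and double deficiencies\<close>

definition perms :: "nat \<Rightarrow> (nat \<Rightarrow> nat) set" where
  "perms n = {\<pi>. \<pi> permutes {1..n}}"

definition DD :: "nat \<Rightarrow> (nat \<Rightarrow> nat) \<Rightarrow> nat" where
  "DD n \<pi> = card {k \<in> {1..n}. \<pi> k < k \<and> k < inv \<pi> k}"

definition order_isomorphic :: "nat list \<Rightarrow> nat list \<Rightarrow> bool" where
  "order_isomorphic xs ys \<longleftrightarrow> length xs = length ys \<and>
     (\<forall>i < length xs. \<forall>j < length xs. xs ! i < xs ! j \<longleftrightarrow> ys ! i < ys ! j)"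

text \<open>The list \<open>map \<pi> [1..<Suc n]\<close> is the one-line notation of \<open>\<pi>\<close>.\<close>

definition Av :: "nat list \<Rightarrow> nat \<Rightarrow> (nat \<Rightarrow> nat) set" where
  "Av p n = {\<pi> \<in> perms n.
     \<not> (\<exists>xs. subseq xs (map \<pi> [1..<Suc n]) \<and> order_isomorphic xs p)}"

definition f321 :: "nat \<Rightarrow> int poly" where
  "f321 n = (\<Sum>\<pi> \<in> Av [3, 2, 1] n. x_var ^ DD n \<pi>)"

lemma finite_Av: "finite (Av p n)"
  by (rule finite_subset[of _ "{\<pi>. \<pi> permutes {1..n}}"])
     (auto simp: Av_def perms_def finite_permutations)

subsection \<open>Bicolored Motzkin paths\<close>

datatype colour = Uncoloured | Red

datatype step = Up | Level colour | Down

fun rise :: "step \<Rightarrow> int" where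
  "rise Up = 1"
| "rise (Level c) = 0"
| "rise Down = - 1"

text \<open>The height of a path after its first \<open>i\<close> steps, i.e. at the start of step \<open>p ! i\<close>.\<close>

definition height :: "step list \<Rightarrow> nat \<Rightarrow> int" where
  "height p i = sum_list (map rise (take i p))"

definition motzkin :: "step list \<Rightarrow> bool" where
  "motzkin p \<longleftrightarrow> (\<forall>i \<le> length p. 0 \<le> height p i) \<and> height p (length p) = 0"

definition paths0 :: "nat \<Rightarrow> step list set" where
  "paths0 n = {p. length p = n \<and> motzkin p}"

definition paths1 :: "nat \<Rightarrow> step list set" where
  "paths1 n = {p \<in> paths0 n. \<forall>i < length p. p ! i = Level Red \<longrightarrow> 0 < height p i}"

definition F0 :: "int poly fps" where
  "F0 = Abs_fps (\<lambda>n. \<Sum>p \<in> paths0 n. x_var ^ count_list p (Level Red))"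

definition F1 :: "int poly fps" where
  "F1 = Abs_fps (\<lambda>n. \<Sum>p \<in> paths1 n. x_var ^ count_list p (Level Red))"

lemma finite_paths0: "finite (paths0 n)"
proof -
  have "c \<in> {Uncoloured, Red}" for c
    by (cases c) auto
  then have "s \<in> {Up, Level Uncoloured, Level Red, Down}" for s
    by (cases s) auto
  then have "paths0 n \<subseteq> {p. set p \<subseteq> {Up, Level Uncoloured, Level Red, Down} \<and> length p = n}"
    by (auto simp: paths0_def)
  then show ?thesis
    by (rule finite_subset) (simp add: finite_lists_length_eq)
qed

lemma finite_paths1: "finite (paths1 n)"
  using finite_paths0 by (simp add: paths1_def)

subsection \<open>Closed forms\<close>

text \<open>The closed forms divide by power series whose leading coefficient is not a unit of
  \<open>\<int>[x]\<close>, so they are stated over the fraction field of \<open>\<int>[x]\<close>, where division of power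
  series is the library's. Library division by \<open>2 * z ^ 2\<close> discards the terms of the dividend of
  degree below 2; requiring divisibility as well makes the quotient exact.\<close>

definition fps_fract :: "'a::idom fps \<Rightarrow> 'a fract fps" where
  "fps_fract F = Abs_fps (\<lambda>n. Fract (fps_nth F n) 1)"

definition fps_sqrt :: "'a::field_char_0 fps \<Rightarrow> 'a fps" where
  "fps_sqrt A = (THE S. fps_nth S 0 = 1 \<and> S ^ 2 = A)"

lemma fps_sqrt_ex1:
  fixes A :: "'a::field_char_0 fps"
  assumes "fps_nth A 0 = 1"
  shows "\<exists>!S. fps_nth S 0 = 1 \<and> S ^ 2 = A"
proof (rule ex_ex1I)
  have "fps_radical (\<lambda>_ _. 1) (Suc 1) A ^ Suc 1 = A"
    using power_radical[of A "\<lambda>_ _. 1" 1] assms by simp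
  moreover have "fps_nth (fps_radical (\<lambda>_ _. 1) (Suc 1) A) 0 = 1"
    by simp
  ultimately show "\<exists>S. fps_nth S 0 = 1 \<and> S ^ 2 = A"
    by (metis Suc_1)
next
  fix S T :: "'a fps"
  assume S: "fps_nth S 0 = 1 \<and> S ^ 2 = A" and T: "fps_nth T 0 = 1 \<and> T ^ 2 = A"
  then have "S = T \<or> S = - T"
    using power2_eq_iff[of S T] by simp
  moreover have "S \<noteq> - T"
  proof
    assume "S = - T"
    then have "fps_nth S 0 = - fps_nth T 0"
      by simp
    with S T have "(1::'a) = - 1"
      by simp
    then show False
      by simp
  qed
  ultimately show "S = T"
    by blast
qed

end

theory Submission
  imports Defs
begin

text \<open>The closed forms come from functional equations, and these from cutting a nonempty path after its
  first return to the axis: it is a level step followed by a path, or an arch \<open>Up # q @ [Down]\<close>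
  followed by a path, in exactly one way (\<open>axis_paths_decomp\<close>, \<open>arch_unique\<close>). Everything
  inside the arch is above the axis, so \<open>q\<close> is counted by \<open>F0\<close> whichever series is being decomposed.
  The resulting recurrence \<open>path_poly_rec\<close> is quadratic for \<open>F0\<close> and, given \<open>F0\<close>, linear for
  \<open>F1\<close>; solving it over the fraction field is \<open>closed_forms\<close>.

  That \<open>F1\<close> counts double deficiencies is shown by a bijection. To a permutation \<open>\<pi>\<close> one
  associates the path whose \<open>k\<close>-th step records how \<open>\<pi> k\<close> and \<open>inv \<pi> k\<close> compare with \<open>k\<close>: both
  larger is an up step, both smaller a down step, a double deficiency a red level step, and a double
  excedance or fixed point an uncoloured level step. The height after \<open>i\<close> steps is the number of
  places up to \<open>i\<close> with values beyond \<open>i\<close>, and also the number of values up to \<open>i\<close> in places beyond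
  \<open>i\<close> (\<open>height_perm_path\<close>). A fixed point at positive height is therefore the middle of a pattern
  321, so for a 321-avoiding \<open>\<pi>\<close> the path reveals which uncoloured steps are fixed points, and
  with them the places and values of all excedances and deficiencies (\<open>marked_perm_path\<close>). As \<open>\<pi>\<close> is
  increasing on both classes, these sets determine it (\<open>inj_on_perm_path\<close>). Conversely, matching the
  sets read off an arbitrary path increasingly yields genuine excedances and deficiencies, because
  up to any point the excess of sources over targets to be matched is the height of the path, which
  is positive after each source (\<open>ex_increasing_matching\<close>, \<open>card_marked_diff\<close>, \<open>perm_path_surj\<close>).\<close>

section \<open>Heights of lattice paths\<close>

lemma height_0 [simp]: "height p 0 = 0"
  by (simp add: height_def)

lemma height_Cons [simp]: "height (s # p) (Suc i) = rise s + height p i"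
  by (simp add: height_def)

lemma height_append: "i \<le> length p \<Longrightarrow> height (p @ q) i = height p i"
  by (simp add: height_def)

lemma height_append_length_plus:
  "height (p @ q) (length p + i) = height p (length p) + height q i"
  by (simp add: height_def)

lemma height_Suc: "i < length p \<Longrightarrow> height p (Suc i) = height p i + rise (p ! i)"
  by (simp add: height_def take_Suc_conv_app_nth)

section \<open>First-return decomposition of bicolored Motzkin paths\<close>

text \<open>Restricting the colours of the level steps on the axis to \<open>C\<close> puts both families of paths under
  one decomposition: \<open>C = UNIV\<close> gives \<open>F0\<close> and \<open>C = {Uncoloured}\<close> gives \<open>F1\<close>.\<close>

definition axis_paths :: "colour set \<Rightarrow> nat \<Rightarrow> step list set" where
  "axis_paths C n =
     {p \<in> paths0 n. \<forall>i < length p. \<forall>c. p ! i = Level c \<and> height p i = 0 \<longrightarrow> c \<in> C}"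

lemma paths0_eq_axis_paths: "paths0 n = axis_paths UNIV n"
  by (simp add: axis_paths_def)

lemma paths1_eq_axis_paths: "paths1 n = axis_paths {Uncoloured} n"
proof -
  have "c \<in> {Uncoloured} \<longleftrightarrow> c \<noteq> Red" for c
    by (cases c) auto
  then show ?thesis
    by (force simp: paths1_def axis_paths_def paths0_def motzkin_def order.order_iff_strict)
qed

lemma finite_axis_paths: "finite (axis_paths C n)"
  using finite_paths0 by (simp add: axis_paths_def)

lemma axis_paths_0: "axis_paths C 0 = {[]}"
  by (auto simp: axis_paths_def paths0_def motzkin_def)

lemma length_axis_paths: "p \<in> axis_paths C n \<Longrightarrow> length p = n"
  by (simp add: axis_paths_def paths0_def)

lemma all_le_Suc_iff: "(\<forall>i \<le> Suc n. P i) \<longleftrightarrow> P 0 \<and> (\<forall>i \<le> n. P (Suc i))"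
  by (metis Suc_le_mono le0 not0_implies_Suc)

lemma Level_Cons_in_axis_paths_iff:
  "Level c # q \<in> axis_paths C (Suc n) \<longleftrightarrow> c \<in> C \<and> q \<in> axis_paths C n"
  by (auto simp: axis_paths_def paths0_def motzkin_def all_le_Suc_iff All_less_Suc2)

lemma Down_Cons_notin_axis_paths: "Down # q \<notin> axis_paths C n"
proof
  assume "Down # q \<in> axis_paths C n"
  then have "\<forall>i \<le> Suc (length q). 0 \<le> height (Down # q) i"
    by (simp add: axis_paths_def paths0_def motzkin_def)
  then have "0 \<le> height (Down # q) (Suc 0)"
    by (metis Suc_le_mono le0)
  then show False
    by simp
qed

lemma height_arch:
  assumes "motzkin q"
  shows "j \<le> length q \<Longrightarrow> height (Up # q @ Down # r) (Suc j) = 1 + height q j"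
    and "height (Up # q @ Down # r) (length q + 2 + j) = height r j"
proof -
  show "height (Up # q @ Down # r) (Suc j) = 1 + height q j" if "j \<le> length q"
    using that by (simp add: height_append)
  have "height (Up # q @ Down # r) (length q + 2 + j)
      = 1 + height (q @ Down # r) (length q + Suc j)"
    by simp
  also have "\<dots> = height r j"
    using assms unfolding height_append_length_plus by (simp add: motzkin_def)
  finally show "height (Up # q @ Down # r) (length q + 2 + j) = height r j" .
qed

text \<open>Inside the arch every height is raised by one, so the arch touches the axis only at its two ends
  and its inner path \<open>q\<close> is free of the restriction to \<open>C\<close>. This is why \<open>F0\<close> enters the equation
  for \<open>F1\<close>.\<close>

lemma arch_in_axis_paths_iff:
  assumes q: "motzkin q"
  shows "Up # q @ Down # r \<in> axis_paths C n
      \<longleftrightarrow> n = length q + 2 + length r \<and> r \<in> axis_paths C (length r)"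
proof -
  let ?p = "Up # q @ Down # r"
  have len: "length ?p = length q + 2 + length r"
    by simp
  \<comment> \<open>Start of the arch, inside the arch, or past its closing step.\<close>
  have split: "i = 0 \<or> (\<exists>j \<le> length q. i = Suc j) \<or> (\<exists>j. i = length q + 2 + j)" for i
  proof (cases "i = 0 \<or> i \<le> Suc (length q)")
    case True
    then show ?thesis
      by (cases i) auto
  next
    case False
    then show ?thesis
      by (metis add_2_eq_Suc' le_Suc_ex not_less_eq_eq)
  qed
  have nth: "?p ! (length q + 2 + j) = r ! j" for j
    by (simp add: nth_append)
  have q_nonneg: "0 \<le> height q j" if "j \<le> length q" for j
    using q that by (simp add: motzkin_def)
  have mot: "motzkin ?p \<longleftrightarrow> motzkin r"
  proof
    assume p: "motzkin ?p"
    have "0 \<le> height r j" if "j \<le> length r" for j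
      using p that height_arch(2)[OF q, of r j] unfolding motzkin_def len
      by (metis nat_add_left_cancel_le)
    moreover have "height r (length r) = 0"
      using p height_arch(2)[OF q, of r "length r"] unfolding motzkin_def len by simp
    ultimately show "motzkin r"
      by (simp add: motzkin_def)
  next
    assume r: "motzkin r"
    have "0 \<le> height ?p i" if "i \<le> length ?p" for i
      using split[of i]
    proof (elim disjE exE conjE)
      fix j assume j: "j \<le> length q" "i = Suc j"
      show ?thesis
        unfolding j(2) using height_arch(1)[OF q j(1), of r] q_nonneg[OF j(1)] by linarith
    next
      fix j assume j: "i = length q + 2 + j"
      with that have "j \<le> length r"
        by simp
      with r j show ?thesis
        using height_arch(2)[OF q, of r j] by (simp only: motzkin_def)
    qed simp
    moreover have "height ?p (length ?p) = 0"
      using r height_arch(2)[OF q, of r "length r"] unfolding len by (simp only: motzkin_def)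
    ultimately show "motzkin ?p"
      by (simp only: motzkin_def) simp
  qed
  have ax: "(\<forall>i < length ?p. \<forall>c. ?p ! i = Level c \<and> height ?p i = 0 \<longrightarrow> c \<in> C)
      \<longleftrightarrow> (\<forall>j < length r. \<forall>c. r ! j = Level c \<and> height r j = 0 \<longrightarrow> c \<in> C)"
    (is "?L \<longleftrightarrow> ?R")
  proof
    assume L: ?L
    show ?R
      using L height_arch(2)[OF q, of r] nth unfolding len by (metis nat_add_left_cancel_less)
  next
    assume R: ?R
    have "c \<in> C" if i: "i < length ?p" and c: "?p ! i = Level c \<and> height ?p i = 0" for i c
      using split[of i]
    proof (elim disjE exE conjE)
      fix j assume j: "j \<le> length q" "i = Suc j"
      show ?thesis
        using c[unfolded j(2)] height_arch(1)[OF q j(1), of r] q_nonneg[OF j(1)] by linarith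
    next
      fix j assume j: "i = length q + 2 + j"
      with i have "j < length r"
        by simp
      with R c j show ?thesis
        using height_arch(2)[OF q, of r j] nth[of j] by metis
    qed (use c in simp)
    then show ?L
      by blast
  qed
  show ?thesis
    unfolding axis_paths_def paths0_def mem_Collect_eq mot ax
    by (simp add: eq_commute[of n] conj_assoc add.assoc)
qed

text \<open>The arch is closed by the first step that takes the rest \<open>r\<close> of the path, measured from
  height \<open>0\<close>, down to \<open>- 1\<close>.\<close>

lemma arch_exists:
  assumes "Up # r \<in> axis_paths C n"
  obtains q1 q2 where "r = q1 @ Down # q2" "motzkin q1"
proof -
  have mot: "motzkin (Up # r)"
    using assms by (simp add: axis_paths_def paths0_def)
  have ge: "- 1 \<le> height r j" if "j \<le> length r" for j
    using mot that unfolding motzkin_def by (force dest: spec[of _ "Suc j"])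
  define j where "j = (LEAST j. height r j = - 1)"
  have last: "height r (length r) = - 1"
    using mot by (simp add: motzkin_def)
  then have hj: "height r j = - 1" and j_le: "j \<le> length r"
    unfolding j_def by (auto intro: LeastI Least_le)
  then obtain k where k: "j = Suc k"
    by (cases j) auto
  have below: "0 \<le> height r i" if "i \<le> k" for i
  proof -
    have "height r i \<noteq> - 1"
      using that k not_less_Least[of i "\<lambda>j. height r j = - 1"] by (simp add: j_def)
    then show ?thesis
      using ge[of i] that k j_le by simp
  qed
  have "height r k + rise (r ! k) = - 1"
    using hj k j_le height_Suc[of k r] by simp
  moreover have "- 1 \<le> rise (r ! k) \<and> (rise (r ! k) = - 1 \<longrightarrow> r ! k = Down)"
    by (cases "r ! k") auto
  ultimately have hk: "height r k = 0" and down: "r ! k = Down"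
    using below[of k] by auto
  have r: "r = take k r @ Down # drop (Suc k) r"
    using id_take_nth_drop[of k r] k j_le down by simp
  have "height (take k r) i = height r i" if "i \<le> k" for i
    using that by (simp add: height_def min_absorb2 min_absorb1)
  then have "motzkin (take k r)"
    using below hk k j_le by (simp add: motzkin_def)
  with r show thesis
    by (rule that)
qed

text \<open>If one inner path were shorter, the down step that closes its arch would take the other inner
  path below its starting height.\<close>

lemma arch_unique:
  assumes eq: "q1 @ Down # q2 = r1 @ Down # r2" and "motzkin q1" "motzkin r1"
  shows "q1 = r1 \<and> q2 = r2"
proof -
  have *: "\<not> length q1 < length r1"
    if e: "q1 @ Down # q2 = r1 @ Down # r2" and m: "motzkin q1" "motzkin r1" for q1 q2 r1 r2
  proof
    assume less: "length q1 < length r1"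
    have "height (q1 @ Down # q2) (length q1 + 1) = - 1"
      using m(1) unfolding height_append_length_plus by (simp add: motzkin_def)
    moreover have "height (r1 @ Down # r2) (length q1 + 1) = height r1 (length q1 + 1)"
      using less by (intro height_append) simp
    moreover have "0 \<le> height r1 (length q1 + 1)"
      using m(2) less by (simp add: motzkin_def)
    ultimately show False
      using e by simp
  qed
  have "length q1 = length r1"
    using *[OF eq assms(2,3)] *[OF eq[symmetric] assms(3,2)] by simp
  with eq show ?thesis
    by simp
qed

definition path_poly :: "colour set \<Rightarrow> nat \<Rightarrow> int poly" where
  "path_poly C n = (\<Sum>p \<in> axis_paths C n. x_var ^ count_list p (Level Red))"

text \<open>The index \<open>i\<close> is the length of the first arch, its two end steps included; it is the summation
  index of the recurrences.\<close>

lemma axis_paths_decomp: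
  assumes "n \<ge> 1"
  shows "axis_paths C n = (\<lambda>(c, q). Level c # q) ` (C \<times> axis_paths C (n - 1))
    \<union> (\<lambda>(i, q, r). Up # q @ Down # r) `
        (SIGMA i:{2..n}. paths0 (i - 2) \<times> axis_paths C (n - i))" (is "?L = ?A \<union> ?B")
proof (intro equalityI subsetI)
  fix p assume p: "p \<in> ?L"
  then have len: "length p = n"
    by (rule length_axis_paths)
  with assms obtain s p' where sp: "p = s # p'"
    by (cases p) auto
  show "p \<in> ?A \<union> ?B"
  proof (cases s)
    case Up
    with p sp obtain q r where qr: "p' = q @ Down # r" "motzkin q"
      using arch_exists by metis
    have r: "n = length q + 2 + length r \<and> r \<in> axis_paths C (length r)"
      using p unfolding sp Up qr(1) arch_in_axis_paths_iff[OF qr(2)] .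
    then have "(length q + 2, q, r) \<in> (SIGMA i:{2..n}. paths0 (i - 2) \<times> axis_paths C (n - i))"
      using qr(2) by (simp add: paths0_def)
    then show ?thesis
      unfolding sp Up qr(1) by (intro UnI2 image_eqI[of _ _ "(length q + 2, q, r)"]) simp_all
  next
    case (Level c)
    have "Level c # p' \<in> axis_paths C (Suc (n - 1))"
      using p assms unfolding sp Level by simp
    then show ?thesis
      unfolding sp Level Level_Cons_in_axis_paths_iff by (intro UnI1 image_eqI[of _ _ "(c, p')"]) simp_all
  next
    case Down
    with p sp show ?thesis
      by (simp add: Down_Cons_notin_axis_paths)
  qed
next
  fix p assume "p \<in> ?A \<union> ?B"
  then show "p \<in> ?L"
  proof
    assume "p \<in> ?A"
    then show ?thesis
      using assms Level_Cons_in_axis_paths_iff[of _ _ C "n - 1"] by auto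
  next
    assume "p \<in> ?B"
    then obtain i q r where *: "p = Up # q @ Down # r" "i \<in> {2..n}" "q \<in> paths0 (i - 2)"
      "r \<in> axis_paths C (n - i)"
      by auto
    then have "motzkin q" "length q = i - 2" "length r = n - i"
      by (auto simp: paths0_def length_axis_paths)
    with * show ?thesis
      by (simp only: arch_in_axis_paths_iff) auto
  qed
qed

lemma path_poly_rec:
  assumes "n \<ge> 1"
  shows "path_poly C n = (\<Sum>c\<in>C. x_var ^ (if c = Red then 1 else 0)) * path_poly C (n - 1)
    + (\<Sum>i = 2..n. path_poly UNIV (i - 2) * path_poly C (n - i))"
proof -
  let ?w = "\<lambda>p. x_var ^ count_list p (Level Red)"
  let ?f = "\<lambda>(c, q). Level c # q" and ?g = "\<lambda>(i::nat, q, r). Up # q @ Down # r"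
  let ?S = "SIGMA i:{2..n}. paths0 (i - 2) \<times> axis_paths C (n - i)"
  have "finite (UNIV :: colour set)"
    by (rule finite_subset[of _ "{Uncoloured, Red}"]) (use colour.exhaust in auto)
  then have finC: "finite C"
    by (rule rev_finite_subset) simp
  have injf: "inj_on ?f (C \<times> axis_paths C (n - 1))"
    by (auto simp: inj_on_def)
  have injg: "inj_on ?g ?S"
  proof (rule inj_onI, clarsimp)
    fix i q r i' q' r'
    assume a: "2 \<le> i" "i \<le> n" "2 \<le> i'" "q \<in> paths0 (i - 2)" "q' \<in> paths0 (i' - 2)"
      "q @ Down # r = q' @ Down # r'"
    then have "motzkin q" "motzkin q'" "length q = i - 2" "length q' = i' - 2"
      by (auto simp: paths0_def)
    then show "i = i' \<and> q = q' \<and> r = r'"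
      using arch_unique[OF a(6)] a(1,3) by auto
  qed
  have "path_poly C n = sum ?w (?f ` (C \<times> axis_paths C (n - 1))) + sum ?w (?g ` ?S)"
    unfolding path_poly_def axis_paths_decomp[OF assms, of C]
    by (rule sum.union_disjoint)
       (auto intro!: finite_imageI finite_SigmaI finC finite_axis_paths finite_paths0)
  also have "sum ?w (?f ` (C \<times> axis_paths C (n - 1)))
      = (\<Sum>(c, q) \<in> C \<times> axis_paths C (n - 1). x_var ^ (if c = Red then 1 else 0) * ?w q)"
    unfolding sum.reindex[OF injf] by (intro sum.cong) auto
  also have "\<dots> = (\<Sum>c\<in>C. x_var ^ (if c = Red then 1 else 0)) * path_poly C (n - 1)"
    unfolding path_poly_def sum_product sum.cartesian_product ..
  also have "sum ?w (?g ` ?S) = (\<Sum>(i, q, r) \<in> ?S. ?w q * ?w r)"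
    unfolding sum.reindex[OF injg] by (intro sum.cong) (auto simp: power_add)
  also have "\<dots> = (\<Sum>i = 2..n. \<Sum>(q, r) \<in> paths0 (i - 2) \<times> axis_paths C (n - i). ?w q * ?w r)"
    by (rule sum.Sigma[symmetric]) (auto intro: finite_axis_paths finite_paths0)
  also have "\<dots> = (\<Sum>i = 2..n. path_poly UNIV (i - 2) * path_poly C (n - i))"
    unfolding path_poly_def sum_product sum.cartesian_product paths0_eq_axis_paths ..
  finally show ?thesis .
qed

lemma path_poly_0: "path_poly C 0 = 1"
  by (simp add: path_poly_def axis_paths_0)

lemma F0_nth: "fps_nth F0 n = path_poly UNIV n"
  by (simp add: F0_def path_poly_def paths0_eq_axis_paths)

lemma F1_nth: "fps_nth F1 n = path_poly {Uncoloured} n"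
  by (simp add: F1_def path_poly_def paths1_eq_axis_paths)

lemma F0_rec:
  assumes "n \<ge> 1"
  shows "fps_nth F0 n = (1 + x_var) * fps_nth F0 (n - 1)
    + (\<Sum>i = 2..n. fps_nth F0 (i - 2) * fps_nth F0 (n - i))"
proof -
  have U: "UNIV = {Uncoloured, Red}"
    using colour.exhaust by auto
  have "(\<Sum>c\<in>UNIV. x_var ^ (if c = Red then 1 else 0)) = 1 + x_var"
    unfolding U by simp
  then show ?thesis
    using path_poly_rec[OF assms, of UNIV] by (simp only: F0_nth)
qed

lemma F1_rec:
  assumes "n \<ge> 1"
  shows "fps_nth F1 n = fps_nth F1 (n - 1)
    + (\<Sum>i = 2..n. fps_nth F0 (i - 2) * fps_nth F1 (n - i))"
  using path_poly_rec[OF assms, of "{Uncoloured}"] by (simp add: F0_nth F1_nth)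

section \<open>Functional equations and closed forms\<close>

lemma fps_eq_if_convolution_rec:
  fixes F G :: "'a::comm_ring_1 fps"
  assumes "fps_nth G 0 = 1"
    and rec: "\<And>n. n \<ge> 1 \<Longrightarrow> fps_nth G n = a * fps_nth G (n - 1)
      + (\<Sum>i = 2..n. fps_nth F (i - 2) * fps_nth G (n - i))"
  shows "G = 1 + fps_const a * fps_X * G + fps_X ^ 2 * F * G"
proof (rule fps_ext)
  fix n
  have conv: "fps_nth (fps_X ^ 2 * F * G) n = (\<Sum>i = 2..n. fps_nth F (i - 2) * fps_nth G (n - i))"
  proof (cases "n < 2")
    case True
    then show ?thesis
      by (simp add: mult.assoc fps_X_power_mult_nth)
  next
    case False
    then obtain m where m: "n = m + 2"
      by (metis le_add_diff_inverse2 not_less)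
    have "(\<Sum>i = 2..n. fps_nth F (i - 2) * fps_nth G (n - i))
        = (\<Sum>i = 0..m. fps_nth F i * fps_nth G (m - i))"
      by (rule sum.reindex_bij_witness[of _ "\<lambda>i. i + 2" "\<lambda>i. i - 2"]) (auto simp: m)
    moreover have "fps_nth (fps_X ^ 2 * F * G) n = fps_nth (F * G) m"
      unfolding mult.assoc fps_X_power_mult_nth m by simp
    ultimately show ?thesis
      by (simp only: fps_mult_nth)
  qed
  show "fps_nth G n = fps_nth (1 + fps_const a * fps_X * G + fps_X ^ 2 * F * G) n"
  proof (cases n)
    case 0
    then show ?thesis
      using assms(1) by (simp add: mult.assoc)
  next
    case (Suc m)
    then show ?thesis
      using rec[of n] unfolding fps_add_nth conv by (simp add: mult.assoc)
  qed
qed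

lemma F0_eq: "F0 = 1 + (1 + fps_const x_var) * fps_X * F0 + fps_X ^ 2 * F0 ^ 2"
proof -
  have "F0 = 1 + fps_const (1 + x_var) * fps_X * F0 + fps_X ^ 2 * F0 * F0"
    by (rule fps_eq_if_convolution_rec[OF _ F0_rec]) (simp_all add: F0_nth path_poly_0)
  then show ?thesis
    by (simp only: fps_const_add[symmetric] fps_const_1_eq_1 power2_eq_square mult.assoc)
qed

lemma F1_eq: "F1 = 1 + fps_X * F1 + fps_X ^ 2 * F0 * F1"
proof -
  have "F1 = 1 + fps_const 1 * fps_X * F1 + fps_X ^ 2 * F0 * F1"
    by (rule fps_eq_if_convolution_rec) (use F1_rec in \<open>simp_all add: F1_nth path_poly_0\<close>)
  then show ?thesis
    by simp
qed

lemma fps_fract_nth: "fps_nth (fps_fract F) n = to_fract (fps_nth F n)"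
  by (simp add: fps_fract_def to_fract_def)

lemma fps_fract_add: "fps_fract (F + G) = fps_fract F + fps_fract G"
  by (rule fps_ext) (simp add: fps_fract_nth)

lemma to_fract_sum: "to_fract (sum f A) = (\<Sum>i\<in>A. to_fract (f i))"
  by (induction A rule: infinite_finite_induct) auto

lemma fps_fract_mult: "fps_fract (F * G) = fps_fract F * fps_fract G"
  by (rule fps_ext) (simp add: fps_fract_nth fps_mult_nth to_fract_sum)

lemma fps_fract_1: "fps_fract 1 = 1"
  by (rule fps_ext) (simp add: fps_fract_nth)

lemma fps_fract_X: "fps_fract fps_X = fps_X"
  by (rule fps_ext) (simp add: fps_fract_nth fps_X_nth)

lemma fps_sqrt_eqI:
  assumes "fps_nth S 0 = 1" and "S ^ 2 = A"
  shows "fps_sqrt A = S"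
proof -
  have "fps_nth A 0 = 1"
    using assms by (auto simp: fps_power_zeroth)
  then show ?thesis
    unfolding fps_sqrt_def using assms by (intro the1_equality fps_sqrt_ex1) auto
qed

text \<open>The discriminant is the square of \<open>1 - (1 + x) * z - 2 * z ^ 2 * f\<close>, whose constant term
  is \<open>1\<close>, so this series is the chosen root. Both quotients follow by substituting it: the numerator
  of the first is \<open>2 * z ^ 2 * f\<close>, and the denominator of the second is
  \<open>2 * (1 - z - z ^ 2 * f)\<close>, twice the reciprocal of \<open>g\<close>.\<close>

lemma closed_forms:
  fixes x f g :: "'a::field_char_0 fps"
  defines "z \<equiv> fps_X"
  defines "S \<equiv> fps_sqrt (1 - 2 * z - 2 * x * z - 3 * z ^ 2 + 2 * x * z ^ 2 + x ^ 2 * z ^ 2)"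
  assumes f: "f = 1 + (1 + x) * z * f + z ^ 2 * f ^ 2"
    and g: "g = 1 + z * g + z ^ 2 * f * g"
  shows "2 * z ^ 2 dvd 1 - (1 + x) * z - S"
    and "f = (1 - (1 + x) * z - S) / (2 * z ^ 2)"
    and "g = 2 / (1 - z + x * z + S)"
proof -
  have "(1 - (1 + x) * z - 2 * z ^ 2 * f) ^ 2
      = (1 - (1 + x) * z) ^ 2 - 4 * z ^ 2 * (f - (1 + x) * z * f - z ^ 2 * f ^ 2)"
    by (simp add: power2_eq_square algebra_simps)
  also have "f - (1 + x) * z * f - z ^ 2 * f ^ 2 = 1"
    using f by (simp add: algebra_simps)
  finally have "(1 - (1 + x) * z - 2 * z ^ 2 * f) ^ 2
      = 1 - 2 * z - 2 * x * z - 3 * z ^ 2 + 2 * x * z ^ 2 + x ^ 2 * z ^ 2"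
    by (simp add: power2_eq_square algebra_simps)
  moreover have "fps_nth (1 - (1 + x) * z - 2 * z ^ 2 * f) 0 = 1"
    by (simp add: z_def)
  ultimately have S: "S = 1 - (1 + x) * z - 2 * z ^ 2 * f"
    unfolding S_def by (intro fps_sqrt_eqI)
  then have num: "1 - (1 + x) * z - S = 2 * z ^ 2 * f"
    by simp
  then show "2 * z ^ 2 dvd 1 - (1 + x) * z - S"
    by simp
  have "2 * z ^ 2 \<noteq> (0 :: 'a fps)"
    by (simp add: z_def)
  then show "f = (1 - (1 + x) * z - S) / (2 * z ^ 2)"
    unfolding num by simp
  have den: "1 - z + x * z + S = 2 * (1 - z - z ^ 2 * f)"
    by (simp add: S algebra_simps)
  have "g * (1 - z - z ^ 2 * f) = 1"
    using g by (simp add: algebra_simps)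
  then have "2 = g * (1 - z + x * z + S)"
    unfolding den mult.left_commute[of g] by (simp only: mult_1_right)
  moreover have "1 - z + x * z + S \<noteq> 0"
    using calculation by auto
  ultimately show "g = 2 / (1 - z + x * z + S)"
    by (metis nonzero_mult_div_cancel_right)
qed


section \<open>Permutations avoiding 321\<close>

definition no_321 :: "(nat \<Rightarrow> nat) \<Rightarrow> bool" where
  "no_321 \<pi> \<longleftrightarrow> \<not> (\<exists>a b c. a < b \<and> b < c \<and> \<pi> b < \<pi> a \<and> \<pi> c < \<pi> b)"

lemma order_isomorphic_321_iff:
  "order_isomorphic xs [3, 2, 1] \<longleftrightarrow> (\<exists>u v w. xs = [u, v, w] \<and> v < u \<and> w < v)"
proof
  assume oi: "order_isomorphic xs [3, 2, 1]"
  then have "length xs = Suc (Suc (Suc 0))"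
    by (simp add: order_isomorphic_def)
  then obtain u v w where xs: "xs = [u, v, w]"
    by (auto simp: length_Suc_conv)
  from oi have "v < u" "w < v"
    unfolding order_isomorphic_def xs by (auto simp: All_less_Suc)
  with xs show "\<exists>u v w. xs = [u, v, w] \<and> v < u \<and> w < v"
    by blast
next
  assume "\<exists>u v w. xs = [u, v, w] \<and> v < u \<and> w < v"
  then show "order_isomorphic xs [3, 2, 1]"
    by (auto simp: order_isomorphic_def less_Suc_eq)
qed

text \<open>A descending triple of a permutation of \<open>{1..n}\<close> lies in \<open>{1..n}\<close>, since every index outside
  is fixed; this lets \<^const>\<open>no_321\<close> quantify over all indices.\<close>

lemma Av_321_iff: "\<pi> \<in> Av [3, 2, 1] n \<longleftrightarrow> \<pi> permutes {1..n} \<and> no_321 \<pi>"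
proof -
  let ?l = "map \<pi> [1..<Suc n]"
  have "(\<exists>xs. subseq xs ?l \<and> order_isomorphic xs [3, 2, 1]) \<longleftrightarrow> \<not> no_321 \<pi>"
    if perm: "\<pi> permutes {1..n}"
  proof
    assume "\<exists>xs. subseq xs ?l \<and> order_isomorphic xs [3, 2, 1]"
    then obtain u v w where sub: "subseq [u, v, w] ?l" and less: "v < u" "w < v"
      unfolding order_isomorphic_321_iff by blast
    from list_emb_ConsD[OF sub] obtain as l1 where l1: "?l = as @ u # l1" "subseq [v, w] l1"
      by blast
    from list_emb_ConsD[OF l1(2)] obtain bs l2 where l2: "l1 = bs @ v # l2" "subseq [w] l2"
      by blast
    from list_emb_ConsD[OF l2(2)] obtain cs l3 where l3: "l2 = cs @ w # l3"
      by blast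
    have nth: "\<pi> (Suc i) = ?l ! i" if "i < n" for i
      using that by (simp del: upt_Suc)
    have l: "?l = as @ u # bs @ v # cs @ w # l3"
      using l1 l2 l3 by simp
    let ?i = "length as" let ?j = "?i + Suc (length bs)" let ?k = "?j + Suc (length cs)"
    have len: "?k < n"
      using arg_cong[OF l, of length] by (simp del: upt_Suc)
    have "\<pi> (Suc ?i) = u" "\<pi> (Suc ?j) = v" "\<pi> (Suc ?k) = w"
      using len by (simp_all only: nth l) (simp_all add: nth_append nth_Cons')
    moreover have "Suc ?i < Suc ?j" "Suc ?j < Suc ?k"
      by simp_all
    ultimately show "\<not> no_321 \<pi>"
      unfolding no_321_def using less by blast
  next
    assume "\<not> no_321 \<pi>"
    then obtain a b c where abc: "a < b" "b < c" "\<pi> b < \<pi> a" "\<pi> c < \<pi> b"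
      by (auto simp: no_321_def)
    have fixed: "\<pi> k = k" if "k \<notin> {1..n}" for k
      using perm that by (simp add: permutes_def)
    have "a \<noteq> 0"
      using abc(3) fixed[of 0] by (cases "a = 0") auto
    moreover have "c \<le> n"
    proof (rule ccontr)
      assume "\<not> c \<le> n"
      then have "\<pi> b \<notin> {1..n}"
        using abc(4) fixed[of c] by simp
      then have "\<pi> b = b"
        using perm by (metis permutes_in_image fixed)
      with \<open>\<not> c \<le> n\<close> abc fixed[of c] show False
        by simp
    qed
    ultimately have "filter (\<lambda>i. i \<in> {a, b, c}) [1..<Suc n] = [a, b, c]"
      using abc by (intro sorted_distinct_set_unique) (auto simp: sorted_wrt_filter simp del: upt_Suc)
    then have "subseq [a, b, c] [1..<Suc n]"
      by (metis subseq_filter_left)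
    then have "subseq (map \<pi> [a, b, c]) ?l"
      by (rule subseq_map)
    with abc show "\<exists>xs. subseq xs ?l \<and> order_isomorphic xs [3, 2, 1]"
      unfolding order_isomorphic_321_iff by auto
  qed
  then show ?thesis
    by (auto simp: Av_def perms_def simp del: upt_Suc)
qed

text \<open>The pigeonhole principle: the \<open>\<pi> b\<close> values below \<open>\<pi> b\<close> do not fit into the \<open>b\<close> places left of
  \<open>b\<close>. Hence a larger value left of an excedance \<open>b\<close> always completes to a pattern 321.\<close>

lemma excedance_right_smaller:
  fixes \<pi> :: "nat \<Rightarrow> nat"
  assumes "bij \<pi>" "b < \<pi> b"
  shows "\<exists>c > b. \<pi> c < \<pi> b"
proof (rule ccontr)
  assume none: "\<not> ?thesis"
  have "{..<\<pi> b} \<subseteq> \<pi> ` {..<b}"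
  proof
    fix v assume v: "v \<in> {..<\<pi> b}"
    obtain k where k: "v = \<pi> k"
      using assms(1) by (meson bij_pointE)
    with none v have "k < b"
      by (metis lessThan_iff linorder_neqE_nat order_less_irrefl)
    with k show "v \<in> \<pi> ` {..<b}"
      by simp
  qed
  then have "card {..<\<pi> b} \<le> card {..<b}"
    by (rule surj_card_le[rotated]) simp
  with assms(2) show False
    by simp
qed

lemma deficiency_left_larger:
  fixes \<pi> :: "nat \<Rightarrow> nat"
  assumes "inj \<pi>" "\<pi> b < b"
  shows "\<exists>a < b. \<pi> b < \<pi> a"
proof (rule ccontr)
  assume none: "\<not> ?thesis"
  have "\<pi> ` {..<b} \<subseteq> {..<\<pi> b}"
  proof clarsimp
    fix k assume "k < b"
    with none assms(1) show "\<pi> k < \<pi> b"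
      by (metis inj_eq linorder_neqE_nat order_less_irrefl)
  qed
  then have "card {..<b} \<le> card {..<\<pi> b}"
    using assms(1) by (intro card_inj_on_le) (auto intro: inj_on_subset)
  with assms(2) show False
    by simp
qed

text \<open>A 321-avoiding permutation is thus increasing on its excedances and on its deficiencies, which is
  what makes it recoverable from the places and values of its excedances and deficiencies.\<close>

lemma no_321_mono_excedances:
  assumes "bij \<pi>" "no_321 \<pi>"
  shows "strict_mono_on {k. k < \<pi> k} \<pi>"
proof (rule strict_mono_onI)
  fix a b :: nat assume *: "b \<in> {k. k < \<pi> k}" "a < b"
  then obtain c where "c > b" "\<pi> c < \<pi> b"
    using excedance_right_smaller[OF assms(1)] by blast
  with assms(2) *(2) have "\<pi> a \<le> \<pi> b"
    unfolding no_321_def by (meson not_less)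
  with *(2) assms(1) show "\<pi> a < \<pi> b"
    by (metis bij_def inj_eq le_neq_implies_less order_less_irrefl)
qed

lemma no_321_mono_deficiencies:
  assumes "inj \<pi>" "no_321 \<pi>"
  shows "strict_mono_on {k. \<pi> k < k} \<pi>"
proof (rule strict_mono_onI)
  fix b c :: nat assume *: "b \<in> {k. \<pi> k < k}" "b < c"
  then obtain a where "a < b" "\<pi> b < \<pi> a"
    using deficiency_left_larger[OF assms(1)] by blast
  with assms(2) *(2) have "\<pi> b \<le> \<pi> c"
    unfolding no_321_def by (meson not_less)
  with *(2) assms(1) show "\<pi> b < \<pi> c"
    by (metis inj_eq le_neq_implies_less order_less_irrefl)
qed

section \<open>The path of a permutation\<close>

text \<open>Drawing an arrow from each \<open>k\<close> to \<open>\<pi> k\<close>, an up step opens a right-going and a left-going arrow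
  at \<open>k\<close>, a down step closes one of each, an uncoloured level step at a double excedance continues a
  right-going arrow, and a red one a left-going arrow. Fixed points are uncoloured as well; for
  321-avoiding permutations the height tells them from double excedances.\<close>

definition step_at :: "(nat \<Rightarrow> nat) \<Rightarrow> nat \<Rightarrow> step" where
  "step_at \<pi> k =
    (if k < \<pi> k \<and> k < inv \<pi> k then Up
     else if \<pi> k < k \<and> inv \<pi> k < k then Down
     else if \<pi> k < k \<and> k < inv \<pi> k then Level Red
     else Level Uncoloured)"

definition perm_path :: "nat \<Rightarrow> (nat \<Rightarrow> nat) \<Rightarrow> step list" where
  "perm_path n \<pi> = map (step_at \<pi>) [1..<Suc n]"

lemma length_perm_path [simp]: "length (perm_path n \<pi>) = n"
  by (simp add: perm_path_def)

lemma nth_perm_path: "k \<in> {1..n} \<Longrightarrow> perm_path n \<pi> ! (k - 1) = step_at \<pi> k"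
  by (auto simp: perm_path_def simp del: upt_Suc)

lemma DD_eq_count: "DD n \<pi> = count_list (perm_path n \<pi>) (Level Red)"
proof -
  have "Level Red = step_at \<pi> k \<longleftrightarrow> \<pi> k < k \<and> k < inv \<pi> k" for k
    by (simp add: step_at_def)
  then have "count_list (perm_path n \<pi>) (Level Red)
      = length (filter (\<lambda>k. \<pi> k < k \<and> k < inv \<pi> k) [1..<Suc n])"
    by (simp add: perm_path_def count_list_eq_length_filter filter_map o_def del: upt_Suc)
  also have "\<dots> = DD n \<pi>"
    unfolding DD_def by (subst distinct_length_filter) (auto intro!: arg_cong[of _ _ card])
  finally show ?thesis
    by simp
qed

lemma inv_eq_self_iff: "bij \<pi> \<Longrightarrow> inv \<pi> k = k \<longleftrightarrow> \<pi> k = k"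
  by (metis bij_inv_eq_iff)

text \<open>Two ways to count the same step: along the right-going arrows and along the left-going ones.\<close>

lemma rise_step_at:
  assumes "bij \<pi>"
  shows "rise (step_at \<pi> k) = of_bool (k < \<pi> k) - of_bool (inv \<pi> k < k)"
    and "rise (step_at \<pi> k) = of_bool (k < inv \<pi> k) - of_bool (\<pi> k < k)"
  using inv_eq_self_iff[OF assms, of k] by (auto simp: step_at_def)

text \<open>Right-going arrows that start in \<open>{1..i}\<close>, minus those that end there, leave the arrows
  crossing from \<open>{1..i}\<close> to its right. Applied to \<open>\<pi>\<close> and to its inverse it gives two readings of the
  height of the path.\<close>

lemma sum_excedances_eq_crossings:
  fixes \<sigma> :: "nat \<Rightarrow> nat"
  assumes "\<sigma> permutes {1..n}"
  shows "(\<Sum>k = 1..i. of_bool (k < \<sigma> k) - of_bool (inv \<sigma> k < k) :: int)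
    = int (card {a \<in> {1..i}. i < \<sigma> a})"
proof -
  let ?E = "{k \<in> {1..i}. k < \<sigma> k}" and ?V = "{k \<in> {1..i}. inv \<sigma> k < k}"
    and ?C = "{a \<in> {1..i}. i < \<sigma> a}"
  have pos: "1 \<le> \<sigma> k \<longleftrightarrow> 1 \<le> k" for k
    using permutes_in_image[OF assms, of k] permutes_not_in[OF assms, of k] by auto
  have V: "?V = \<sigma> ` (?E - ?C)"
  proof (intro equalityI subsetI)
    fix v assume v: "v \<in> ?V"
    have eq: "\<sigma> (inv \<sigma> v) = v"
      using assms by (simp add: permutes_inverses)
    with v pos[of "inv \<sigma> v"] have "inv \<sigma> v \<in> ?E - ?C"
      by auto
    with eq[symmetric] show "v \<in> \<sigma> ` (?E - ?C)"
      by (rule image_eqI)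
  next
    fix v assume "v \<in> \<sigma> ` (?E - ?C)"
    then show "v \<in> ?V"
      using pos permutes_inverses(2)[OF assms] by auto
  qed
  have "card ?V = card (?E - ?C)"
    unfolding V by (intro card_image inj_on_subset[OF permutes_inj[OF assms]]) simp
  also have "\<dots> = card ?E - card ?C"
    by (intro card_Diff_subset) auto
  finally have "card ?V = card ?E - card ?C" .
  moreover have "card ?C \<le> card ?E"
    by (intro card_mono) auto
  ultimately have "int (card ?V) = int (card ?E) - int (card ?C)"
    by simp
  then show ?thesis
    by (simp add: sum_subtractf sum_of_bool_eq Int_def)
qed

lemma height_perm_path:
  assumes "\<pi> permutes {1..n}" "i \<le> n"
  shows "height (perm_path n \<pi>) i = int (card {a \<in> {1..i}. i < \<pi> a})"
    and "height (perm_path n \<pi>) i = int (card {a \<in> {1..i}. i < inv \<pi> a})"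
proof -
  have "height (perm_path n \<pi>) i = sum_list (map (\<lambda>k. rise (step_at \<pi> k)) [1..<Suc i])"
    using assms(2) by (simp add: height_def perm_path_def take_map o_def del: upt_Suc)
  also have "\<dots> = (\<Sum>k = 1..i. rise (step_at \<pi> k))"
    by (subst interv_sum_list_conv_sum_set_nat) (metis atLeastLessThanSuc_atLeastAtMost set_upt)
  finally have h: "height (perm_path n \<pi>) i = (\<Sum>k = 1..i. rise (step_at \<pi> k))" .
  have bij: "bij \<pi>"
    using assms(1) by (rule permutes_bij)
  show "height (perm_path n \<pi>) i = int (card {a \<in> {1..i}. i < \<pi> a})"
    unfolding h rise_step_at(1)[OF bij] by (rule sum_excedances_eq_crossings[OF assms(1)])
  show "height (perm_path n \<pi>) i = int (card {a \<in> {1..i}. i < inv \<pi> a})"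
    using sum_excedances_eq_crossings[OF permutes_inv[OF assms(1)], of i]
    unfolding h rise_step_at(2)[OF bij] inv_inv_eq[OF bij] .
qed

lemma height_perm_path_pos:
  assumes "\<pi> permutes {1..n}" "i \<le> n"
  shows "0 < height (perm_path n \<pi>) i \<longleftrightarrow> (\<exists>a \<le> i. i < \<pi> a)"
    and "0 < height (perm_path n \<pi>) i \<longleftrightarrow> (\<exists>a \<le> i. i < inv \<pi> a)"
proof -
  have *: "0 < int (card {a \<in> {1..i}. i < \<sigma> a}) \<longleftrightarrow> (\<exists>a \<le> i. i < \<sigma> a)"
    if "\<sigma> permutes {1..n}" for \<sigma>
  proof -
    have "\<sigma> 0 = 0"
      using that by (simp add: permutes_def)
    then have "(\<exists>a \<le> i. i < \<sigma> a) \<longleftrightarrow> {a \<in> {1..i}. i < \<sigma> a} \<noteq> {}"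
      by (auto simp: Suc_le_eq) (metis gr0I not_less_zero)
    then show ?thesis
      by (simp add: card_gt_0_iff)
  qed
  show "0 < height (perm_path n \<pi>) i \<longleftrightarrow> (\<exists>a \<le> i. i < \<pi> a)"
    unfolding height_perm_path(1)[OF assms] by (rule *[OF assms(1)])
  show "0 < height (perm_path n \<pi>) i \<longleftrightarrow> (\<exists>a \<le> i. i < inv \<pi> a)"
    unfolding height_perm_path(2)[OF assms] by (rule *[OF permutes_inv[OF assms(1)]])
qed

text \<open>At a double deficiency \<open>k\<close> the arrow from \<open>k\<close> to \<open>\<pi> k\<close> crosses the gap just before \<open>k\<close>, so red steps
  lie above the axis.\<close>

lemma perm_path_in_paths1:
  assumes "\<pi> permutes {1..n}"
  shows "perm_path n \<pi> \<in> paths1 n"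
proof -
  have "{a \<in> {1..n}. n < \<pi> a} = {}"
    using permutes_in_image[OF assms] by (auto simp: not_less)
  then have "motzkin (perm_path n \<pi>)"
    unfolding motzkin_def by (simp add: height_perm_path(1)[OF assms])
  moreover have "0 < height (perm_path n \<pi>) i"
    if "i < n" "perm_path n \<pi> ! i = Level Red" for i
  proof -
    have "\<pi> (Suc i) < Suc i"
      using that nth_perm_path[of "Suc i" n \<pi>] by (auto simp: step_at_def split: if_splits)
    moreover have "inv \<pi> (\<pi> (Suc i)) = Suc i"
      using assms by (simp add: permutes_inverses)
    ultimately show ?thesis
      using that(1) by (subst height_perm_path_pos(2)[OF assms]) (auto intro!: exI[of _ "\<pi> (Suc i)"])
  qed
  ultimately show ?thesis
    by (simp add: paths1_def paths0_def)
qed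

section \<open>Excedances and deficiencies read off a path\<close>

text \<open>For the path of a 321-avoiding permutation, an up or down step or a level step off the axis
  of the given colour describes one of four sets: the places and the values of excedances
  (\<open>Up\<close> and \<open>Down\<close> with \<open>Uncoloured\<close>), and the values and the places of deficiencies (\<open>Up\<close> and
  \<open>Down\<close> with \<open>Red\<close>).\<close>

definition marked :: "step list \<Rightarrow> step \<Rightarrow> colour \<Rightarrow> nat set" where
  "marked p s c = {k \<in> {1..length p}.
     p ! (k - 1) = s \<or> p ! (k - 1) = Level c \<and> 0 < height p (k - 1)}"

lemma finite_marked [simp]: "finite (marked p s c)"
  by (simp add: marked_def)

text \<open>A fixed point under a right-going arrow is also under a left-going one, because the heights
  counted by both kinds agree; the start of the first, the fixed point and the start of the second then
  form a pattern 321. So fixed points lie on the axis and double excedances above it.\<close>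

lemma marked_perm_path:
  assumes "\<pi> permutes {1..n}" "no_321 \<pi>"
  shows "marked (perm_path n \<pi>) Up Uncoloured = {k. k < \<pi> k}"
    and "marked (perm_path n \<pi>) Down Uncoloured = {k. inv \<pi> k < k}"
    and "marked (perm_path n \<pi>) Up Red = {k. k < inv \<pi> k}"
    and "marked (perm_path n \<pi>) Down Red = {k. \<pi> k < k}"
proof -
  let ?p = "perm_path n \<pi>"
  have bij: "bij \<pi>"
    using assms(1) by (rule permutes_bij)
  have out: "\<pi> k = k \<and> inv \<pi> k = k" if "k \<notin> {1..n}" for k
    using assms(1) that inv_eq_self_iff[OF bij] by (simp add: permutes_def)
  have red: "0 < height ?p (k - 1)" if "k \<in> {1..n}" "step_at \<pi> k = Level Red" for k
    using perm_path_in_paths1[OF assms(1)] that nth_perm_path[OF that(1), of \<pi>]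
    by (auto simp: paths1_def)
  have unc: "0 < height ?p (k - 1) \<longleftrightarrow> k < \<pi> k"
    if k: "k \<in> {1..n}" "step_at \<pi> k = Level Uncoloured" for k
  proof
    assume pos: "0 < height ?p (k - 1)"
    have less: "k - 1 \<le> n"
      using k by auto
    show "k < \<pi> k"
    proof (rule ccontr)
      assume "\<not> k < \<pi> k"
      with k(2) have fix_k: "\<pi> k = k"
        using inv_eq_self_iff[OF bij, of k] by (auto simp: step_at_def split: if_splits)
      from pos obtain a where a: "a \<le> k - 1" "k - 1 < \<pi> a"
        unfolding height_perm_path_pos(1)[OF assms(1) less] by blast
      from pos obtain v where v: "v \<le> k - 1" "k - 1 < inv \<pi> v"
        unfolding height_perm_path_pos(2)[OF assms(1) less] by blast
      let ?c = "inv \<pi> v"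
      have c: "\<pi> ?c = v"
        using assms(1) by (simp add: permutes_inverses)
      have "\<pi> a \<noteq> k" "?c \<noteq> k"
        using a v c k(1) fix_k inv_eq_self_iff[OF bij, of k] permutes_inverses(2)[OF assms(1)]
      by fastforce+
      then have "a < k" "k < ?c" "\<pi> k < \<pi> a" "\<pi> ?c < \<pi> k"
        using a v c k(1) fix_k by auto
      with assms(2) show False
        unfolding no_321_def by blast
    qed
  next
    assume "k < \<pi> k"
    moreover from this k(2) have "inv \<pi> k < k"
      using inv_eq_self_iff[OF bij, of k] by (auto simp: step_at_def split: if_splits)
    moreover have "\<pi> (inv \<pi> k) = k"
      using assms(1) by (simp add: permutes_inverses)
    ultimately show "0 < height ?p (k - 1)"
      using k(1) by (subst height_perm_path_pos(1)[OF assms(1)]) (auto intro!: exI[of _ "inv \<pi> k"])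
  qed
  have mem: "k \<in> marked ?p s c \<longleftrightarrow> k \<in> {1..n} \<and>
      (step_at \<pi> k = s \<or> step_at \<pi> k = Level c \<and> (c = Red \<or> k < \<pi> k))" for k s c
    using red[of k] unc[of k] nth_perm_path[of k n \<pi>] by (cases c) (auto simp: marked_def)
  have "k \<in> marked ?p Up Uncoloured \<longleftrightarrow> k < \<pi> k"
    "k \<in> marked ?p Down Uncoloured \<longleftrightarrow> inv \<pi> k < k"
    "k \<in> marked ?p Up Red \<longleftrightarrow> k < inv \<pi> k"
    "k \<in> marked ?p Down Red \<longleftrightarrow> \<pi> k < k" for k
    unfolding mem using out[of k] inv_eq_self_iff[OF bij, of k]
    by (cases "k \<in> {1..n}"; auto simp: step_at_def split: if_splits)+
  then show "marked ?p Up Uncoloured = {k. k < \<pi> k}"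
    "marked ?p Down Uncoloured = {k. inv \<pi> k < k}"
    "marked ?p Up Red = {k. k < inv \<pi> k}"
    "marked ?p Down Red = {k. \<pi> k < k}"
    by blast+
qed

section \<open>The bijection between 321-avoiding permutations and paths\<close>

lemma strict_mono_on_eqI:
  fixes f g :: "'a::linorder \<Rightarrow> 'b::linorder"
  assumes "finite A" "strict_mono_on A f" "strict_mono_on A g" "f ` A = g ` A" "a \<in> A"
  shows "f a = g a"
proof -
  let ?l = "sorted_list_of_set A"
  have "sorted_wrt (<) (map h ?l)" if "strict_mono_on A h" for h :: "'a \<Rightarrow> 'b"
    using assms(1) that unfolding sorted_wrt_map
    by (intro sorted_wrt_mono_rel[OF _ strict_sorted_list_of_set[of A]]) (auto dest: strict_mono_onD)
  then have "map f ?l = map g ?l"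
    using assms(1-4) by (intro strict_sorted_equal) auto
  then show ?thesis
    using assms(1,5) by auto
qed

lemma inj_on_perm_path: "inj_on (perm_path n) (Av [3, 2, 1] n)"
proof (rule inj_onI)
  fix \<pi> \<sigma> assume "\<pi> \<in> Av [3, 2, 1] n" "\<sigma> \<in> Av [3, 2, 1] n" and eq: "perm_path n \<pi> = perm_path n \<sigma>"
  then have \<pi>: "\<pi> permutes {1..n}" "no_321 \<pi>" and \<sigma>: "\<sigma> permutes {1..n}" "no_321 \<sigma>"
    unfolding Av_321_iff by blast+
  note sets = marked_perm_path[OF \<pi>, unfolded eq marked_perm_path[OF \<sigma>]]
  have image: "\<tau> ` {k. k < \<tau> k} = {v. inv \<tau> v < v}" "\<tau> ` {k. \<tau> k < k} = {v. v < inv \<tau> v}"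
    if "\<tau> permutes {1..n}" for \<tau> :: "nat \<Rightarrow> nat"
  proof -
    have "v \<in> \<tau> ` {k. P k (\<tau> k)} \<longleftrightarrow> P (inv \<tau> v) v" for P v
      using permutes_inverses[OF that] by (metis (mono_tags, lifting) image_iff mem_Collect_eq)
    from this[of _ "(<)"] this[of _ "\<lambda>k l. l < k"] show "\<tau> ` {k. k < \<tau> k} = {v. inv \<tau> v < v}"
      "\<tau> ` {k. \<tau> k < k} = {v. v < inv \<tau> v}"
      by auto
  qed
  have fin: "finite {k. k < \<sigma> k}" "finite {k. \<sigma> k < k}"
    by (simp_all flip: marked_perm_path[OF \<sigma>])
  note mono = no_321_mono_excedances[OF permutes_bij] no_321_mono_deficiencies[OF permutes_inj]
  show "\<pi> = \<sigma>"
  proof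
    fix k
    consider "k < \<sigma> k" | "\<sigma> k < k" | "\<sigma> k = k"
      by linarith
    then show "\<pi> k = \<sigma> k"
    proof cases
      case 1
      then show ?thesis
        using image(1)[OF \<pi>(1)] image(1)[OF \<sigma>(1)] mono(1)[OF \<pi>] mono(1)[OF \<sigma>] fin(1) sets
        by (intro strict_mono_on_eqI[of "{k. k < \<sigma> k}"]) auto
    next
      case 2
      then show ?thesis
        using image(2)[OF \<pi>(1)] image(2)[OF \<sigma>(1)] mono(2)[OF \<pi>] mono(2)[OF \<sigma>] fin(2) sets
        by (intro strict_mono_on_eqI[of "{k. \<sigma> k < k}"]) auto
    next
      case 3
      then have "k \<notin> {k. k < \<pi> k}" "k \<notin> {k. \<pi> k < k}"
        unfolding sets[symmetric] by simp_all
      with 3 show ?thesis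
        by simp
    qed
  qed
qed

text \<open>The order isomorphism from \<open>A\<close> to \<open>B\<close> preserves ranks. Since \<open>B\<close> has fewer elements up to \<open>k\<close>
  than \<open>A\<close>, the element of \<open>B\<close> with the rank of \<open>k\<close> comes after \<open>k\<close>.\<close>

lemma ex_increasing_matching:
  fixes A B :: "nat set"
  assumes fin: "finite A" "finite B" and card: "card A = card B"
    and more: "\<And>k. k \<in> A \<Longrightarrow> card (B \<inter> {..k}) < card (A \<inter> {..k})"
  shows "\<exists>f. bij_betw f A B \<and> strict_mono_on A f \<and> (\<forall>k \<in> A. k < f k)"
proof -
  obtain r where r: "bij_betw r {..<card A} A" "strict_mono_on {..<card A} r"
    using ex_bij_betw_strict_mono_card[OF fin(1)] .
  obtain s where s: "bij_betw s {..<card A} B" "strict_mono_on {..<card A} s"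
    using ex_bij_betw_strict_mono_card[OF fin(2)] unfolding card .
  let ?q = "inv_into {..<card A} r"
  \<comment> \<open>\<open>?q\<close> is the rank in \<open>A\<close>, and \<open>s\<close> enumerates \<open>B\<close> by rank.\<close>
  have q: "?q a \<in> {..<card A}" "r (?q a) = a" if "a \<in> A" for a
    using that r(1) inv_into_into[of a r "{..<card A}"] by (auto simp: bij_betw_def f_inv_into_f)
  have q_mono: "?q a < ?q b" if "a \<in> A" "b \<in> A" "a < b" for a b
    using q[OF that(1)] q[OF that(2)] that(3) strict_mono_on_less[OF r(2), of "?q a" "?q b"] by metis
  define f where "f = s \<circ> ?q"
  have bij: "bij_betw f A B"
    unfolding f_def by (intro bij_betw_trans[OF bij_betw_inv_into[OF r(1)] s(1)])
  have mono: "strict_mono_on A f"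
    unfolding f_def o_def by (intro strict_mono_onI strict_mono_onD[OF s(2)] q(1) q_mono)
  have "k < f k" if k: "k \<in> A" for k
  proof -
    have "f ` (A \<inter> {..k}) = B \<inter> {..f k}"
      using bij strict_mono_on_less_eq[OF mono] k by (fastforce simp: bij_betw_def)
    then have "card (A \<inter> {..k}) = card (B \<inter> {..f k})"
      using bij card_image[of f "A \<inter> {..k}"] by (metis bij_betw_def inf_le1 inj_on_subset)
    with more[OF k] have "card (B \<inter> {..k}) < card (B \<inter> {..f k})"
      by simp
    moreover have "card (B \<inter> {..f k}) \<le> card (B \<inter> {..k})" if "f k \<le> k"
      using that fin(2) by (intro card_mono) auto
    ultimately show ?thesis
      by linarith
  qed
  with bij mono show ?thesis
    by blast
qed

text \<open>The counting condition of the matching, for \<open>c = Uncoloured\<close> and \<open>c = Red\<close> alike: level steps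
  of colour \<open>c\<close> off the axis belong to both sets and cancel.\<close>

lemma card_marked_diff:
  assumes "k \<le> length p"
  shows "int (card (marked p Up c \<inter> {..k})) - int (card (marked p Down c \<inter> {..k})) = height p k"
  using assms
proof (induction k)
  case 0
  have "marked p s c \<inter> {..0} = {}" for s
    by (auto simp: marked_def)
  then show ?case
    by simp
next
  case (Suc k)
  have step: "card (marked p s c \<inter> {..Suc k})
      = card (marked p s c \<inter> {..k}) + of_bool (Suc k \<in> marked p s c)" for s
    by (auto simp: atMost_Suc Int_insert_right)
  have "of_bool (Suc k \<in> marked p Up c) - of_bool (Suc k \<in> marked p Down c) = rise (p ! k)"
    using Suc.prems by (cases "p ! k") (auto simp: marked_def)
  then show ?case
    using Suc.IH Suc.prems height_Suc[of k p] unfolding step by simp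
qed

lemma height_marked_Up:
  assumes "motzkin p" "k \<in> marked p Up c"
  shows "0 < height p k"
proof -
  have k: "k \<in> {1..length p}" "p ! (k - 1) = Up \<or> p ! (k - 1) = Level c \<and> 0 < height p (k - 1)"
    using assms(2) by (simp_all add: marked_def)
  moreover have "0 \<le> height p (k - 1)"
    using assms(1) k(1) by (auto simp: motzkin_def)
  ultimately show ?thesis
    using height_Suc[of "k - 1" p] by auto
qed

lemma ex_marked_matching:
  assumes "motzkin p"
  shows "\<exists>f. bij_betw f (marked p Up c) (marked p Down c) \<and> strict_mono_on (marked p Up c) f
    \<and> (\<forall>k \<in> marked p Up c. k < f k)"
proof (rule ex_increasing_matching)
  have "marked p s c \<inter> {..length p} = marked p s c" for s
    by (auto simp: marked_def)
  then show "card (marked p Up c) = card (marked p Down c)"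
    using card_marked_diff[of "length p" p c] assms by (simp add: motzkin_def)
  fix k assume k: "k \<in> marked p Up c"
  then have "k \<le> length p"
    by (simp add: marked_def)
  with k show "card (marked p Down c \<inter> {..k}) < card (marked p Up c \<inter> {..k})"
    using card_marked_diff[of k p c] height_marked_Up[OF assms k] by linarith
qed simp_all

text \<open>The preimage sends excedance places to excedance values by one increasing matching, deficiency
  places to deficiency values by the inverse of another, and fixes the indices of the level steps on the axis. In a
  pattern 321 two entries are both excedances or both deficiencies, unless the middle one is fixed: a
  fixed first entry makes the others deficiencies, and a fixed last entry makes the others excedances.
  A fixed middle entry would lie under an arrow, off the axis.\<close>

lemma perm_path_surj:
  assumes p: "p \<in> paths1 n"
  shows "\<exists>\<pi> \<in> Av [3, 2, 1] n. perm_path n \<pi> = p"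
proof -
  have mot: "motzkin p" and len: "length p = n"
    and red: "\<And>k. k \<in> {1..n} \<Longrightarrow> p ! (k - 1) = Level Red \<Longrightarrow> 0 < height p (k - 1)"
    using p by (auto simp: paths1_def paths0_def)
  let ?E = "marked p Up Uncoloured" and ?V = "marked p Down Uncoloured"
  let ?D = "marked p Down Red" and ?W = "marked p Up Red"
  have sub: "?E \<union> ?D \<subseteq> {1..n}"
    by (auto simp: marked_def len)
  have disj: "?E \<inter> ?D = {}" "?V \<inter> ?W = {}"
    by (auto simp: marked_def)
  have un: "?V \<union> ?W = ?E \<union> ?D"
    using red by (auto simp: marked_def len)
  obtain f where f: "bij_betw f ?E ?V" "strict_mono_on ?E f" "\<And>k. k \<in> ?E \<Longrightarrow> k < f k"
    using ex_marked_matching[OF mot] by metis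
  obtain g where g: "bij_betw g ?W ?D" "strict_mono_on ?W g" "\<And>k. k \<in> ?W \<Longrightarrow> k < g k"
    using ex_marked_matching[OF mot] by metis
  define h where "h = inv_into ?W g"
  have h: "bij_betw h ?D ?W" "\<And>k. k \<in> ?D \<Longrightarrow> g (h k) = k"
    using g(1) by (auto simp: h_def bij_betw_inv_into bij_betw_inv_into_right)
  then have h_in: "\<And>k. k \<in> ?D \<Longrightarrow> h k \<in> ?W"
    by (auto simp: bij_betw_def)
  have h_less: "h k < k" if "k \<in> ?D" for k
    using g(3)[OF h_in[OF that]] h(2)[OF that] by simp
  define \<pi> where "\<pi> = (\<lambda>k. if k \<in> ?E then f k else if k \<in> ?D then h k else k)"
  have \<pi>E: "\<pi> k = f k" if "k \<in> ?E" for k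
    using that by (simp add: \<pi>_def)
  have \<pi>D: "\<pi> k = h k" if "k \<in> ?D" for k
    using that disj by (auto simp: \<pi>_def)
  have \<pi>F: "\<pi> k = k" if "k \<notin> ?E \<union> ?D" for k
    using that by (simp add: \<pi>_def)
  have "bij_betw \<pi> ?E ?V" "bij_betw \<pi> ?D ?W"
    using f(1) h(1) \<pi>E \<pi>D by (simp_all cong: bij_betw_cong)
  then have "bij_betw \<pi> (?E \<union> ?D) (?E \<union> ?D)"
    using bij_betw_combine[of \<pi> ?E ?V ?D ?W] disj un by simp
  then have "\<pi> permutes ?E \<union> ?D"
    using \<pi>F by (rule bij_imp_permutes)
  then have perm: "\<pi> permutes {1..n}"
    using sub by (rule permutes_subset)
  have inv: "inv \<pi> v = k" if "\<pi> k = v" for k v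
    using perm that by (metis permutes_inverses(2))
  have lt: "k < \<pi> k" if "k \<in> ?E" for k
    using f(3)[OF that] \<pi>E[OF that] by simp
  have gt: "\<pi> k < k" if "k \<in> ?D" for k
    using h_less[OF that] \<pi>D[OF that] by simp
  have V: "inv \<pi> k < k" if "k \<in> ?V" for k
  proof -
    obtain j where "j \<in> ?E" "f j = k"
      using f(1) \<open>k \<in> ?V\<close> by (metis bij_betw_def imageE)
    then show ?thesis
      using f(3)[of j] \<pi>E[of j] inv[of j k] by simp
  qed
  have W: "k < inv \<pi> k" if "k \<in> ?W" for k
  proof -
    obtain j where "j \<in> ?D" "h j = k"
      using h(1) \<open>k \<in> ?W\<close> by (metis bij_betw_def imageE)
    then show ?thesis
      using h_less[of j] \<pi>D[of j] inv[of j k] by simp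
  qed
  have F: "inv \<pi> k = k" if "k \<notin> ?V \<union> ?W" for k
    using that \<pi>F[of k] inv[of k k] un by simp
  have iff: "k < \<pi> k \<longleftrightarrow> k \<in> ?E" "\<pi> k < k \<longleftrightarrow> k \<in> ?D"
    "inv \<pi> k < k \<longleftrightarrow> k \<in> ?V" "k < inv \<pi> k \<longleftrightarrow> k \<in> ?W" for k
    using lt[of k] gt[of k] \<pi>F[of k] V[of k] W[of k] F[of k] by force+
  \<comment> \<open>The four sets determine the type of each step, so the path of \<open>\<pi>\<close> is \<open>p\<close>.\<close>
  have "step_at \<pi> k = p ! (k - 1)" if "k \<in> {1..n}" for k
  proof (cases "p ! (k - 1)")
    case (Level c)
    with that red[of k] show ?thesis
      unfolding step_at_def iff by (cases c) (auto simp: marked_def len)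
  qed (use that in \<open>auto simp: step_at_def iff marked_def len\<close>)
  then have path: "perm_path n \<pi> = p"
    by (intro nth_equalityI) (auto simp: len nth_perm_path[of "Suc _", simplified])
  have "no_321 \<pi>"
    unfolding no_321_def
  proof clarify
    fix a b c assume abc: "a < b" "b < c" "\<pi> b < \<pi> a" "\<pi> c < \<pi> b"
    have E: "\<pi> i < \<pi> j" if "i < \<pi> i" "j < \<pi> j" "i < j" for i j
      using that f(2) \<pi>E unfolding iff by (simp add: strict_mono_onD)
    have D: "\<pi> i < \<pi> j" if "\<pi> i < i" "\<pi> j < j" "i < j" for i j
      using that h(2) h_in \<pi>D strict_mono_on_less[OF g(2), of "h i" "h j"] unfolding iff by metis
    consider "b < \<pi> b" | "\<pi> b < b" | "\<pi> b = b"
      by linarith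
    then show False
    proof cases
      case 1
      then show ?thesis
        using E[of a b] abc by linarith
    next
      case 2
      then show ?thesis
        using D[of b c] abc by linarith
    next
      case 3
      have b: "b \<in> {1..n}"
      proof (rule ccontr)
        assume "b \<notin> {1..n}"
        then have "n < b"
          using abc(1) by auto
        then have "\<pi> a \<notin> {1..n}"
          using abc(3) 3 by simp
        then have "\<pi> a = a"
          using perm by (metis permutes_in_image permutes_not_in)
        with abc 3 show False
          by simp
      qed
      have "step_at \<pi> b = Level Uncoloured"
        using 3 by (simp add: step_at_def)
      then have "p ! (b - 1) = Level Uncoloured"
        using nth_perm_path[OF b, of \<pi>] path by simp
      moreover have "0 < height p (b - 1)"
        using abc 3 b height_perm_path_pos(1)[OF perm, of "b - 1"] path by (auto intro!: exI[of _ a])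
      ultimately have "b \<in> ?E"
        using b by (simp add: marked_def len)
      with 3 lt[of b] show False
        by simp
    qed
  qed
  with perm have "\<pi> \<in> Av [3, 2, 1] n"
    unfolding Av_321_iff by simp
  with path show ?thesis
    by (rule bexI)
qed

lemma F1_eq_f321: "fps_nth F1 n = f321 n"
proof -
  have "perm_path n ` Av [3, 2, 1] n = paths1 n"
  proof (intro equalityI subsetI)
    fix p assume "p \<in> perm_path n ` Av [3, 2, 1] n"
    then obtain \<pi> where "\<pi> \<in> Av [3, 2, 1] n" "p = perm_path n \<pi>"
      by blast
    then show "p \<in> paths1 n"
      using perm_path_in_paths1 unfolding Av_321_iff by blast
  next
    fix p assume "p \<in> paths1 n"
    then show "p \<in> perm_path n ` Av [3, 2, 1] n"
      using perm_path_surj by blast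
  qed
  then have "bij_betw (perm_path n) (Av [3, 2, 1] n) (paths1 n)"
    using inj_on_perm_path by (simp add: bij_betw_def)
  then show ?thesis
    unfolding F1_def f321_def DD_eq_count fps_nth_Abs_fps
    by (rule sum.reindex_bij_betw[symmetric])
qed

theorem mainTheorem1:
  shows
    "F1 = Abs_fps f321
     \<and> (let z = fps_X; x = fps_const x_var in
          F0 = 1 + (1 + x) * z * F0 + z ^ 2 * F0 ^ 2
          \<and> F1 = 1 + z * F1 + z ^ 2 * F0 * F1)
     \<and> (let z = fps_X; x = fps_fract (fps_const x_var);
            S = fps_sqrt (1 - 2 * z - 2 * x * z - 3 * z ^ 2 + 2 * x * z ^ 2 + x ^ 2 * z ^ 2) in
          2 * z ^ 2 dvd 1 - (1 + x) * z - S
          \<and> fps_fract F0 = (1 - (1 + x) * z - S) / (2 * z ^ 2)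
          \<and> fps_fract F1 = 2 / (1 - z + x * z + S))
     \<and> (let g = fps_nth F0 in
          g 0 = 1 \<and> f321 0 = 1
          \<and> (\<forall>n \<ge> 1. g n = (1 + x_var) * g (n - 1) + (\<Sum>i = 2..n. g (i - 2) * g (n - i)))
          \<and> (\<forall>n \<ge> 1. f321 n = f321 (n - 1) + (\<Sum>i = 2..n. g (i - 2) * f321 (n - i))))"
proof -
  let ?x = "fps_fract (fps_const x_var)"
  note hom = fps_fract_add fps_fract_mult fps_fract_1 fps_fract_X power2_eq_square
  have F: "F1 = Abs_fps f321"
    by (rule fps_ext) (simp add: F1_eq_f321)
  have f: "fps_fract F0 = 1 + (1 + ?x) * fps_X * fps_fract F0 + fps_X ^ 2 * fps_fract F0 ^ 2"
    using arg_cong[OF F0_eq, of fps_fract] by (simp only: hom)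
  have g: "fps_fract F1 = 1 + fps_X * fps_fract F1 + fps_X ^ 2 * fps_fract F0 * fps_fract F1"
    using arg_cong[OF F1_eq, of fps_fract] by (simp only: hom)
  have "fps_nth F0 0 = 1" "f321 0 = 1"
    by (simp_all add: F0_nth path_poly_0 flip: F1_eq_f321 add: F1_nth)
  then show ?thesis
    unfolding Let_def
    using F F0_eq F1_eq closed_forms[OF f g] F0_rec F1_rec[unfolded F1_eq_f321]
    by (intro conjI allI impI)
qed

end
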